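(* Let $(X,\|\cdot\|_X)$ be a Banach space and let $\Phi$ be an autonomous dynamical system on $X$ which has a global attractor $\mathcal{A}_0$ in $X$. Let $\mathcal{D}$ be a collection of random subsets of $X$. For each $\epsilon>0$ let $\Phi_\epsilon$ be a continuous random dynamical system on $X$ over a metric dynamical system $(\Omega,\mathcal{F},P,(\theta_t)_{t\in\mathbb{R}})$, and suppose that $\Phi_\epsilon$ has a $\mathcal{D}$-random attractor $\mathcal{A}_\epsilon=\{\mathcal{A}_\epsilon(\omega)\}_{\omega\in\Omega}\in\mathcal{D}$ and a random absorbing set $E_\epsilon=\{E_\epsilon(\omega)\}_{\omega\in\Omega}\in\mathcal{D}$ in $\mathcal{D}$. Assume: (1) for $P$-a.e. $\omega\in\Omega$, for all $t\ge 0$, all sequences $\epsilon_n>0$ with $\epsilon_n\to 0$, and all $x_n,x\in X$ with $x_n\to x$ in $X$, one has $\lim_{n\to\infty}\Phi_{\epsilon_n}(t,\omega,x_n)=\Phi(t)x$; (2) there is a deterministic positive constant $c$ such that for $P$-a.e. $\omega\in\Omega$, $\limsup_{\epsilon\to 0}\|E_\epsilon(\omega)\|_X\le c$, where $\|E_\epsilon(\omega)\|_X=\sup_{x\in E_\epsilon(\omega)}\|x\|_X$; (3) there exists $\epsilon_0>0$ such that for $P$-a.e. $\omega\in\Omega$ the set $\bigcup_{0<\epsilon\le\epsilon_0}\mathcal{A}_\epsilon(\omega)$ is precompact in $X$. Then for $P$-a.e. $\omega\in\Omega$, $$\mathrm{dist}(\mathcal{A}_\epsilon(\omega),\mathcal{A}_0)\to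 0\quad\text{as }\epsilon\to 0.$$
   Context: $\mathrm{dist}(Y,Z)=\sup_{y\in Y}\inf_{z\in Z}\|y-z\|_X$ is the Hausdorff semi-metric. The global attractor $\mathcal{A}_0$ of $\Phi$ is a compact invariant set ($\Phi(t)\mathcal{A}_0=\mathcal{A}_0$ for all $t\ge0$) that attracts every bounded subset of $X$ uniformly: $\mathrm{dist}(\Phi(t)B,\mathcal{A}_0)\to0$ as $t\to\infty$ for every bounded $B\subseteq X$. A metric dynamical system $(\Omega,\mathcal{F},P,(\theta_t)_{t\in\mathbb{R}})$ is a probability space with a $(\mathcal{B}(\mathbb{R})\times\mathcal{F},\mathcal{F})$-measurable map $\theta:\mathbb{R}\times\Omega\to\Omega$ such that $\theta_0=\mathrm{id}$, $\theta_{s+t}=\theta_t\circ\theta_s$ and $\theta_tP=P$ for all $s,t$. A continuous random dynamical system $\phi$ on $X$ over it is a $(\mathcal{B}(\mathbb{R}^+)\times\mathcal{F}\times\mathcal{B}(X),\mathcal{B}(X))$-measurable map $\phi:\mathbb{R}^+\times\Omega\times X\to X$ such that for $P$-a.e. $\omega$: $\phi(0,\omega,\cdot)=\mathrm{id}_X$; $\phi(t+s,\omega,\cdot)=\phi(t,\theta_s\omega,\cdot)\circ\phi(s,\omega,\cdot)$ for all $t,s\ge0$; and $\phi(t,\omega,\cdot)$ is continuous for all $t\ge0$. Let $\mathcal{D}$ be a collection of random subsets $\{B(\omega)\}_{\omega\in\Omega}$ of $X$. A random absorbing set for $\phi$ in $\mathcal{D}$ is $\{K(\omega)\}_{\omega\in\Omega}\in\mathcal{D}$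 such that for every $B\in\mathcal{D}$ and $P$-a.e. $\omega$ there is $T(B,\omega)>0$ with $\phi(t,\theta_{-t}\omega,B(\theta_{-t}\omega))\subseteq K(\omega)$ for all $t\ge T(B,\omega)$. A $\mathcal{D}$-random attractor for $\phi$ is a random set $\{\mathcal{A}(\omega)\}_{\omega\in\Omega}$ such that for $P$-a.e. $\omega$: (i) $\mathcal{A}(\omega)$ is compact, and $\omega\mapsto d(x,\mathcal{A}(\omega))$ is measurable for every $x\in X$; (ii) $\phi(t,\omega,\mathcal{A}(\omega))=\mathcal{A}(\theta_t\omega)$ for all $t\ge0$; (iii) for every $B\in\mathcal{D}$, $\lim_{t\to\infty}\mathrm{dist}(\phi(t,\theta_{-t}\omega,B(\theta_{-t}\omega)),\mathcal{A}(\omega))=0$.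
   Formalization: The exceptional P-null sets in the random attractor property and in the absorption property (there for each family of absorbed sets B_ε in D) are assumed common to all ε>0; with null sets depending on ε the claim is false. *)

theory Defs
  imports "HOL-Probability.Probability"
begin

section \<open>Hausdorff semi-metric\<close>

text \<open>
  Distances to a set take values in \<^typ>\<open>ennreal\<close>, so that the infimum over the empty set is
  \<open>\<infinity>\<close>, the supremum over the empty set is 0 and unbounded suprema are \<open>\<infinity>\<close>. The library's
  \<^const>\<open>infdist\<close> is 0 for the empty set, which would make the empty set attract everything.
\<close>

definition point_dist :: "'x::real_normed_vector \<Rightarrow> 'x set \<Rightarrow> ennreal" where
  "point_dist y Z = (INF z\<in>Z. ennreal (norm (y - z)))"

definition hausdorff_semidist :: "'x::real_normed_vector set \<Rightarrow> 'x set \<Rightarrow> ennreal" where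
  "hausdorff_semidist Y Z = (SUP y\<in>Y. point_dist y Z)"

definition set_norm :: "'x::real_normed_vector set \<Rightarrow> ennreal" where
  "set_norm Y = (SUP y\<in>Y. ennreal (norm y))"

definition precompact :: "'x::topological_space set \<Rightarrow> bool" where
  "precompact Y \<longleftrightarrow> compact (closure Y)"


section \<open>Autonomous dynamical systems\<close>

text \<open>Time is \<open>t \<ge> 0\<close>; values at negative times are irrelevant throughout.\<close>

definition autonomous_ds :: "(real \<Rightarrow> 'x::banach \<Rightarrow> 'x) \<Rightarrow> bool" where
  "autonomous_ds \<Phi> \<longleftrightarrow>
     \<Phi> 0 = id \<and>
     (\<forall>t\<ge>0. \<forall>s\<ge>0. \<Phi> (t + s) = \<Phi> t \<circ> \<Phi> s) \<and>
     (\<forall>t\<ge>0. continuous_on UNIV (\<Phi> t))"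

definition global_attractor :: "(real \<Rightarrow> 'x::banach \<Rightarrow> 'x) \<Rightarrow> 'x set \<Rightarrow> bool" where
  "global_attractor \<Phi> A \<longleftrightarrow>
     compact A \<and>
     (\<forall>t\<ge>0. \<Phi> t ` A = A) \<and>
     (\<forall>B. bounded B \<longrightarrow> ((\<lambda>t. hausdorff_semidist (\<Phi> t ` B) A) \<longlongrightarrow> 0) at_top)"


section \<open>Random dynamical systems\<close>

locale metric_dynamical_system = prob_space P for P :: "'w measure" +
  fixes \<theta> :: "real \<Rightarrow> 'w \<Rightarrow> 'w"
  assumes measurable_theta: "(\<lambda>(t, \<omega>). \<theta> t \<omega>) \<in> measurable (borel \<Otimes>\<^sub>M P) P"
    and theta_0: "\<And>\<omega>. \<omega> \<in> space P \<Longrightarrow> \<theta> 0 \<omega> = \<omega>"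
    and theta_add: "\<And>s t \<omega>. \<omega> \<in> space P \<Longrightarrow> \<theta> (s + t) \<omega> = \<theta> t (\<theta> s \<omega>)"
    and theta_preserves: "\<And>t. distr P P (\<theta> t) = P"

definition continuous_rds ::
  "'w measure \<Rightarrow> (real \<Rightarrow> 'w \<Rightarrow> 'w) \<Rightarrow> (real \<Rightarrow> 'w \<Rightarrow> 'x::banach \<Rightarrow> 'x) \<Rightarrow> bool" where
  "continuous_rds P \<theta> \<phi> \<longleftrightarrow>
     (\<lambda>(t, \<omega>, x). \<phi> t \<omega> x) \<in> measurable (restrict_space borel {0..} \<Otimes>\<^sub>M (P \<Otimes>\<^sub>M borel)) borel \<and>
     (AE \<omega> in P.
        \<phi> 0 \<omega> = id \<and>
        (\<forall>t\<ge>0. \<forall>s\<ge>0. \<phi> (t + s) \<omega> = \<phi> t (\<theta> s \<omega>) \<circ> \<phi> s \<omega>) \<and>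
        (\<forall>t\<ge>0. continuous_on UNIV (\<phi> t \<omega>)))"

text \<open>
  A random subset is a family of subsets indexed by the sample space. Measurability is not part of
  the notion; it is required separately of random attractors below. Collections of measurable
  families are covered, since \<open>D\<close> ranges over arbitrary sets of such families.
\<close>

type_synonym ('w, 'x) random_set = "'w \<Rightarrow> 'x set"

definition pullback_image ::
  "(real \<Rightarrow> 'w \<Rightarrow> 'w) \<Rightarrow> (real \<Rightarrow> 'w \<Rightarrow> 'x \<Rightarrow> 'x) \<Rightarrow> ('w, 'x) random_set \<Rightarrow> real \<Rightarrow> 'w \<Rightarrow> 'x set" where
  "pullback_image \<theta> \<phi> B t \<omega> = \<phi> t (\<theta> (- t) \<omega>) ` B (\<theta> (- t) \<omega>)"

definition absorbs_at ::
  "(real \<Rightarrow> 'w \<Rightarrow> 'w) \<Rightarrow> (real \<Rightarrow> 'w \<Rightarrow> 'x \<Rightarrow> 'x) \<Rightarrow> ('w, 'x) random_set \<Rightarrow> ('w, 'x) random_set \<Rightarrow>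
    'w \<Rightarrow> bool" where
  "absorbs_at \<theta> \<phi> K B \<omega> \<longleftrightarrow> (\<exists>T>0. \<forall>t\<ge>T. pullback_image \<theta> \<phi> B t \<omega> \<subseteq> K \<omega>)"

definition random_absorbing_set ::
  "'w measure \<Rightarrow> (real \<Rightarrow> 'w \<Rightarrow> 'w) \<Rightarrow> ('w, 'x) random_set set \<Rightarrow>
    (real \<Rightarrow> 'w \<Rightarrow> 'x \<Rightarrow> 'x) \<Rightarrow> ('w, 'x) random_set \<Rightarrow> bool" where
  "random_absorbing_set P \<theta> D \<phi> K \<longleftrightarrow>
     K \<in> D \<and> (\<forall>B\<in>D. AE \<omega> in P. absorbs_at \<theta> \<phi> K B \<omega>)"

definition random_attractor_at ::
  "(real \<Rightarrow> 'w \<Rightarrow> 'w) \<Rightarrow> ('w, 'x::banach) random_set set \<Rightarrow>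
    (real \<Rightarrow> 'w \<Rightarrow> 'x \<Rightarrow> 'x) \<Rightarrow> ('w, 'x) random_set \<Rightarrow> 'w \<Rightarrow> bool" where
  "random_attractor_at \<theta> D \<phi> A \<omega> \<longleftrightarrow>
     compact (A \<omega>) \<and>
     (\<forall>t\<ge>0. \<phi> t \<omega> ` A \<omega> = A (\<theta> t \<omega>)) \<and>
     (\<forall>B\<in>D. ((\<lambda>t. hausdorff_semidist (pullback_image \<theta> \<phi> B t \<omega>) (A \<omega>)) \<longlongrightarrow> 0) at_top)"

definition random_attractor ::
  "'w measure \<Rightarrow> (real \<Rightarrow> 'w \<Rightarrow> 'w) \<Rightarrow> ('w, 'x::banach) random_set set \<Rightarrow>
    (real \<Rightarrow> 'w \<Rightarrow> 'x \<Rightarrow> 'x) \<Rightarrow> ('w, 'x) random_set \<Rightarrow> bool" where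
  "random_attractor P \<theta> D \<phi> A \<longleftrightarrow>
     (\<forall>x. (\<lambda>\<omega>. point_dist x (A \<omega>)) \<in> borel_measurable P) \<and>
     (AE \<omega> in P. random_attractor_at \<theta> D \<phi> A \<omega>)"


section \<open>Families of random attractors and absorbing sets\<close>

text \<open>
  A statement about \<open>P\<close>-almost every \<open>\<omega>\<close> and all members of an uncountable family of systems is
  sensitive to whether the exceptional null sets depend on the member. For families, ``for
  \<open>P\<close>-a.e. \<open>\<omega>\<close>'' means that one null set serves all indices. With null sets depending on the index,
  upper semicontinuity of random attractors fails: for \<open>\<theta>\<^sub>t = id\<close> on \<open>[0,1]\<close> with Lebesgue measure
  and \<open>\<phi>\<^sub>\<epsilon>(t,\<omega>,x) = exp(-t) x\<close> on the reals, put \<open>A\<^sub>\<epsilon>(\<omega>) = {0}\<close> for all \<open>\<omega>\<close> except one \<open>g(\<epsilon>)\<close>, where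
  \<open>A\<^sub>\<epsilon>(g(\<epsilon>)) = {1}\<close> and \<open>g\<close> maps every interval \<open>(0,\<delta>)\<close> onto \<open>[0,1]\<close>.

  In the absorption property the null set may depend on the absorbed random set, so for families it
  may depend on the family of absorbed sets. A family with one member gives back the notions for
  a single system.
\<close>

definition random_attractor_family ::
  "'w measure \<Rightarrow> (real \<Rightarrow> 'w \<Rightarrow> 'w) \<Rightarrow> ('w, 'x::banach) random_set set \<Rightarrow> 'i set \<Rightarrow>
    ('i \<Rightarrow> real \<Rightarrow> 'w \<Rightarrow> 'x \<Rightarrow> 'x) \<Rightarrow> ('i \<Rightarrow> ('w, 'x) random_set) \<Rightarrow> bool" where
  "random_attractor_family P \<theta> D I \<phi> A \<longleftrightarrow>
     (\<forall>i\<in>I. random_attractor P \<theta> D (\<phi> i) (A i)) \<and>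
     (AE \<omega> in P. \<forall>i\<in>I. random_attractor_at \<theta> D (\<phi> i) (A i) \<omega>)"

definition random_absorbing_family ::
  "'w measure \<Rightarrow> (real \<Rightarrow> 'w \<Rightarrow> 'w) \<Rightarrow> ('w, 'x) random_set set \<Rightarrow> 'i set \<Rightarrow>
    ('i \<Rightarrow> real \<Rightarrow> 'w \<Rightarrow> 'x \<Rightarrow> 'x) \<Rightarrow> ('i \<Rightarrow> ('w, 'x) random_set) \<Rightarrow> bool" where
  "random_absorbing_family P \<theta> D I \<phi> K \<longleftrightarrow>
     (\<forall>i\<in>I. random_absorbing_set P \<theta> D (\<phi> i) (K i)) \<and>
     (\<forall>B. (\<forall>i\<in>I. B i \<in> D) \<longrightarrow> (AE \<omega> in P. \<forall>i\<in>I. absorbs_at \<theta> (\<phi> i) (K i) (B i) \<omega>))"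

lemma random_attractor_family_singleton:
  "random_attractor_family P \<theta> D {i} \<phi> A \<longleftrightarrow> random_attractor P \<theta> D (\<phi> i) (A i)"
  by (auto simp: random_attractor_family_def random_attractor_def)

lemma random_absorbing_family_singleton:
  "random_absorbing_family P \<theta> D {i} \<phi> K \<longleftrightarrow> random_absorbing_set P \<theta> D (\<phi> i) (K i)"
  by (auto simp: random_absorbing_family_def random_absorbing_set_def)

end

theory Submission
  imports Defs
begin

text \<open>
  The argument is pathwise and by compactness. Fix a typical \<open>\<omega>\<close> and let \<open>y\<close> be a limit of points
  \<open>y\<^sub>n \<in> A\<^sub>\<epsilon>\<^sub>n(\<omega>)\<close> with \<open>\<epsilon>\<^sub>n \<rightarrow> 0\<close>. Because the union of the attractors is precompact, it is enough to
  show that every such \<open>y\<close> has distance 0 from \<open>A\<^sub>0\<close> (\<open>semidist_tendsto_0_if_limit_points\<close>).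

  Invariance lets one follow \<open>y\<^sub>n\<close> backwards in time: for each natural number \<open>m\<close> there is \<open>x\<^sub>n\<close> in
  the attractor over \<open>\<theta>\<^sub>-\<^sub>m \<omega>\<close> that is carried to \<open>y\<^sub>n\<close> in time \<open>m\<close>. Precompactness over \<open>\<theta>\<^sub>-\<^sub>m \<omega>\<close>
  gives a limit \<open>x\<close> of a subsequence of the \<open>x\<^sub>n\<close>, convergence of the perturbed systems gives
  \<open>y = \<Phi>(m) x\<close>, and the bound on the absorbing sets, which contain the attractors
  (\<open>attractor_subset_absorbing\<close>), puts \<open>x\<close> into a ball \<open>B\<close> that does not depend on \<open>m\<close>
  (\<open>limit_point_in_image_cball\<close>). So \<open>y\<close> lies in \<open>\<Phi>(m) B\<close> for all \<open>m\<close>, and since \<open>A\<^sub>0\<close> attracts \<open>B\<close>,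
  its distance from \<open>A\<^sub>0\<close> is 0. The limit \<open>y\<close> is fixed before \<open>m\<close>, so no diagonal sequence arises.

  The hypotheses hold almost surely at \<open>\<omega>\<close>, whereas the argument uses them at \<open>\<theta>\<^sub>-\<^sub>m \<omega>\<close>. Since
  \<open>\<theta>\<close> preserves \<open>P\<close> and only countably many times \<open>m\<close> occur, this costs only a null set
  (\<open>AE_shift_nat\<close>).
\<close>

lemma point_dist_triangle:
  "point_dist y Z \<le> ennreal (norm (y - y')) + point_dist y' Z"
proof -
  have "point_dist y Z - ennreal (norm (y - y')) \<le> point_dist y' Z"
    unfolding point_dist_def[of y']
  proof (rule INF_greatest)
    fix z assume "z \<in> Z"
    then have "point_dist y Z \<le> ennreal (norm (y - z))"
      unfolding point_dist_def by (rule INF_lower)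
    also have "\<dots> \<le> ennreal (norm (y - y')) + ennreal (norm (y' - z))"
      using norm_triangle_ineq[of "y - y'" "y' - z"] by (simp add: ennreal_leI flip: ennreal_plus)
    finally show "point_dist y Z - ennreal (norm (y - y')) \<le> ennreal (norm (y' - z))"
      by (simp add: ennreal_minus_le_iff)
  qed
  then show ?thesis by (simp add: ennreal_minus_le_iff)
qed

text \<open>
  Otherwise points \<open>y\<^sub>n\<close> of the sets would stay a fixed distance away from \<open>Z\<close>, and so would
  the limit of a convergent subsequence, because the distance from \<open>Z\<close> is 1-Lipschitz.
\<close>

lemma semidist_tendsto_0_if_limit_points:
  fixes A :: "real \<Rightarrow> 'x::real_normed_vector set"
  assumes "\<epsilon>0 > 0" and precompact: "precompact (\<Union>\<epsilon>\<in>{0<..\<epsilon>0}. A \<epsilon>)"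
    and limit_points: "\<And>e y l. \<lbrakk>\<And>n::nat. e n > 0; e \<longlonglongrightarrow> 0; \<And>n. y n \<in> A (e n); y \<longlonglongrightarrow> l\<rbrakk>
      \<Longrightarrow> point_dist l Z = 0"
  shows "((\<lambda>\<epsilon>. hausdorff_semidist (A \<epsilon>) Z) \<longlongrightarrow> 0) (at_right 0)"
proof (rule order_tendstoI)
  fix a :: ennreal assume "0 < a"
  then obtain b where b: "0 < b" "b < a" using dense by blast
  show "\<forall>\<^sub>F \<epsilon> in at_right 0. hausdorff_semidist (A \<epsilon>) Z < a"
  proof (rule ccontr)
    assume not_ev: "\<not> ?thesis"
    have "\<exists>\<epsilon> y. 0 < \<epsilon> \<and> \<epsilon> \<le> \<epsilon>0 \<and> \<epsilon> < inverse (real (Suc n)) \<and> y \<in> A \<epsilon> \<and> b < point_dist y Z" for n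
    proof -
      define r where "r = min \<epsilon>0 (inverse (real (Suc n)))"
      have "r > 0" using \<open>\<epsilon>0 > 0\<close> by (simp add: r_def)
      then obtain \<epsilon> where \<epsilon>: "0 < \<epsilon>" "\<epsilon> < r" "\<not> hausdorff_semidist (A \<epsilon>) Z < a"
        using not_ev unfolding eventually_at_right_field by auto
      then have "b < hausdorff_semidist (A \<epsilon>) Z" using b by auto
      then obtain y where "y \<in> A \<epsilon>" "b < point_dist y Z"
        unfolding hausdorff_semidist_def less_SUP_iff by blast
      with \<epsilon> show ?thesis unfolding r_def by auto
    qed
    then obtain e y where ey: "\<And>n. 0 < e n" "\<And>n. e n \<le> \<epsilon>0" "\<And>n. e n < inverse (real (Suc n))"
        "\<And>n. y n \<in> A (e n)" "\<And>n. b < point_dist (y n) Z"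
      by metis
    have e: "e \<longlonglongrightarrow> 0"
      by (rule tendsto_sandwich[OF _ _ tendsto_const LIMSEQ_inverse_real_of_nat])
        (use ey in \<open>auto intro!: always_eventually less_imp_le\<close>)
    have "y n \<in> closure (\<Union>\<epsilon>\<in>{0<..\<epsilon>0}. A \<epsilon>)" for n
      using ey closure_subset by fastforce
    then obtain l r where r: "strict_mono r" and l: "(y \<circ> r) \<longlonglongrightarrow> l"
      using precompact unfolding precompact_def compact_def by metis
    have "point_dist l Z = 0"
      by (rule limit_points[where e = "e \<circ> r" and y = "y \<circ> r"])
        (use ey l LIMSEQ_subseq_LIMSEQ[OF e r] in auto)
    then have "b \<le> ennreal (norm (y (r n) - l))" for n
      using ey(5)[of "r n"] point_dist_triangle[of "y (r n)" Z l] by simp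
    moreover have "(\<lambda>n. ennreal (norm (y (r n) - l))) \<longlonglongrightarrow> ennreal 0"
      using l by (intro tendsto_ennrealI tendsto_norm_zero) (simp add: LIM_zero o_def)
    ultimately have "b \<le> ennreal 0"
      by (intro LIMSEQ_le_const) auto
    with b show False by simp
  qed
qed simp

text \<open>
  This is one backward step of fixed length: \<open>\<phi> \<epsilon>\<close> maps \<open>A' \<epsilon>\<close>, the attractor in the past,
  onto \<open>A \<epsilon>\<close>, the attractor in the present. The radius \<open>c'\<close> exceeds \<open>c\<close> because the upper limit
  gives the bound \<open>c'\<close> for all small \<open>\<epsilon>\<close>, but in general not the bound \<open>c\<close>.
\<close>

lemma limit_point_in_image_cball:
  fixes \<phi> :: "real \<Rightarrow> 'x::real_normed_vector \<Rightarrow> 'x" and e :: "nat \<Rightarrow> real"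
  assumes "\<epsilon>0 > 0" and precompact: "precompact (\<Union>\<epsilon>\<in>{0<..\<epsilon>0}. A' \<epsilon>)"
    and subset: "\<And>\<epsilon>. \<epsilon> > 0 \<Longrightarrow> A' \<epsilon> \<subseteq> E' \<epsilon>"
    and bound: "Limsup (at_right 0) (\<lambda>\<epsilon>. set_norm (E' \<epsilon>)) \<le> ennreal c"
    and c: "0 \<le> c" "c < c'"
    and image: "\<And>\<epsilon>. \<epsilon> > 0 \<Longrightarrow> \<phi> \<epsilon> ` A' \<epsilon> = A \<epsilon>"
    and convergence: "\<And>e xs x. \<lbrakk>\<And>n::nat. e n > 0; e \<longlonglongrightarrow> 0; xs \<longlonglongrightarrow> x\<rbrakk>
      \<Longrightarrow> (\<lambda>n. \<phi> (e n) (xs n)) \<longlonglongrightarrow> \<psi> x"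
    and e: "\<And>n. e n > 0" "e \<longlonglongrightarrow> 0"
    and y: "\<And>n. y n \<in> A (e n)" "y \<longlonglongrightarrow> l"
  shows "l \<in> \<psi> ` cball 0 c'"
proof -
  have e_right: "filterlim e (at_right 0) sequentially"
    using e order_less_imp_not_eq2[OF e(1)] by (auto simp: filterlim_at)
  have "Limsup (at_right 0) (\<lambda>\<epsilon>. set_norm (E' \<epsilon>)) < ennreal c'"
    using bound c by (auto simp: ennreal_less_iff intro: le_less_trans)
  then have "\<forall>\<^sub>F \<epsilon> in at_right 0. set_norm (E' \<epsilon>) < ennreal c'"
    by (rule Limsup_lessD)
  then have "\<forall>\<^sub>F n in sequentially. set_norm (E' (e n)) < ennreal c'"
    using e_right by (rule eventually_compose_filterlim)
  moreover have "\<forall>\<^sub>F n in sequentially. e n < \<epsilon>0"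
    using e(2) \<open>\<epsilon>0 > 0\<close> by (rule order_tendstoD)
  ultimately obtain N where
    N: "\<And>n. set_norm (E' (e (n + N))) < ennreal c'" "\<And>n. e (n + N) < \<epsilon>0"
    unfolding eventually_sequentially by (metis (full_types) le_add2 le_trans nle_le)
  have "\<exists>x\<in>A' (e (n + N)). \<phi> (e (n + N)) x = y (n + N)" for n
    using image[OF e(1)[of "n + N"]] y(1)[of "n + N"] by (metis imageE)
  then obtain x where x: "\<And>n. x n \<in> A' (e (n + N))" "\<And>n. \<phi> (e (n + N)) (x n) = y (n + N)"
    by metis
  have "x n \<in> closure (\<Union>\<epsilon>\<in>{0<..\<epsilon>0}. A' \<epsilon>)" for n
    using x(1)[of n] e(1)[of "n + N"] N(2)[of n] closure_subset by fastforce
  then obtain z r where r: "strict_mono r" and z: "(x \<circ> r) \<longlonglongrightarrow> z"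
    using precompact unfolding precompact_def compact_def by metis
  have "x n \<in> cball 0 c'" for n
  proof -
    have "ennreal (norm (x n)) \<le> set_norm (E' (e (n + N)))"
      unfolding set_norm_def using x(1) subset e(1) by (intro SUP_upper) auto
    also have "\<dots> < ennreal c'" by (rule N)
    finally show ?thesis using c by (simp add: ennreal_less_iff)
  qed
  then have "(x \<circ> r) n \<in> cball 0 c'" for n
    unfolding o_apply by this
  then have "z \<in> cball 0 c'"
    using closed_cball z closed_sequentially by blast
  moreover have "l = \<psi> z"
  proof (rule LIMSEQ_unique)
    have shift: "strict_mono (\<lambda>n. r n + N)" using r by (simp add: strict_mono_def)
    show "(\<lambda>n. y (r n + N)) \<longlonglongrightarrow> l"
      using LIMSEQ_subseq_LIMSEQ[OF y(2) shift] by (simp add: o_def)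
    have "(\<lambda>n. \<phi> (e (r n + N)) (x (r n))) \<longlonglongrightarrow> \<psi> z"
      using LIMSEQ_subseq_LIMSEQ[OF e(2) shift] e(1) z by (intro convergence) (simp_all add: o_def)
    then show "(\<lambda>n. y (r n + N)) \<longlonglongrightarrow> \<psi> z" by (simp add: x(2))
  qed
  ultimately show ?thesis by blast
qed

lemma point_dist_global_attractor_eq_0:
  assumes "global_attractor \<Phi> A0" and "bounded B" and "\<And>m::nat. y \<in> \<Phi> (real m) ` B"
  shows "point_dist y A0 = 0"
proof -
  have "((\<lambda>t. hausdorff_semidist (\<Phi> t ` B) A0) \<longlongrightarrow> 0) at_top"
    using assms unfolding global_attractor_def by blast
  then have "(\<lambda>m. hausdorff_semidist (\<Phi> (real m) ` B) A0) \<longlonglongrightarrow> 0"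
    by (rule filterlim_compose) (rule filterlim_real_sequentially)
  moreover have "point_dist y A0 \<le> hausdorff_semidist (\<Phi> (real m) ` B) A0" for m
    unfolding hausdorff_semidist_def using assms(3) by (rule SUP_upper)
  ultimately have "point_dist y A0 \<le> 0"
    by (intro LIMSEQ_le_const) auto
  then show ?thesis by simp
qed

lemma (in metric_dynamical_system) AE_shift_nat:
  assumes "AE \<omega> in P. Q \<omega>"
  shows "AE \<omega> in P. \<forall>m::nat. Q (\<theta> (- real m) \<omega>)"
  unfolding AE_all_countable
proof
  fix m :: nat
  have "\<theta> (- real m) \<in> measurable P P"
    using measurable_compose[OF measurable_Pair1' measurable_theta, of "- real m"] by simp
  moreover have "AE \<omega> in distr P P (\<theta> (- real m)). Q \<omega>"
    unfolding theta_preserves by (rule assms)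
  ultimately show "AE \<omega> in P. Q (\<theta> (- real m) \<omega>)"
    by (rule AE_distrD)
qed

lemma (in metric_dynamical_system) random_attractor_image_from_past:
  assumes "\<omega> \<in> space P" and "0 \<le> t" and "random_attractor_at \<theta> D \<phi> A (\<theta> (- t) \<omega>)"
  shows "\<phi> t (\<theta> (- t) \<omega>) ` A (\<theta> (- t) \<omega>) = A \<omega>"
proof -
  have "\<theta> t (\<theta> (- t) \<omega>) = \<omega>"
    using theta_add[of \<omega> "- t" t] theta_0[of \<omega>] assms(1) by simp
  then show ?thesis using assms(2,3) by (simp add: random_attractor_at_def)
qed

text \<open>
  By invariance the pullback image of the attractor under itself is the attractor at every time, so
  absorption at a single late time already gives the inclusion. A natural number is a good choice of
  this time, since invariance is then needed on countably many fibres only.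
\<close>

lemma (in metric_dynamical_system) attractor_subset_absorbing:
  assumes "\<omega> \<in> space P" and "\<And>m::nat. random_attractor_at \<theta> D \<phi> A (\<theta> (- real m) \<omega>)"
    and "absorbs_at \<theta> \<phi> K A \<omega>"
  shows "A \<omega> \<subseteq> K \<omega>"
proof -
  obtain T where T: "\<And>t. t \<ge> T \<Longrightarrow> pullback_image \<theta> \<phi> A t \<omega> \<subseteq> K \<omega>"
    using assms(3) unfolding absorbs_at_def by blast
  obtain m :: nat where "T \<le> real m" using real_arch_simple by blast
  then have "pullback_image \<theta> \<phi> A (real m) \<omega> \<subseteq> K \<omega>" by (rule T)
  then show ?thesis
    unfolding pullback_image_def
    using random_attractor_image_from_past[OF assms(1) _ assms(2)] by simp
qed

theorem theorem3p1:
  fixes \<Phi> :: "real \<Rightarrow> 'x::banach \<Rightarrow> 'x"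
    and A0 :: "'x set"
    and P :: "'w measure"
    and \<theta> :: "real \<Rightarrow> 'w \<Rightarrow> 'w"
    and D :: "('w, 'x) random_set set"
    and \<Phi>\<^sub>\<epsilon> :: "real \<Rightarrow> real \<Rightarrow> 'w \<Rightarrow> 'x \<Rightarrow> 'x"
    and A E :: "real \<Rightarrow> ('w, 'x) random_set"
    and c :: real
  assumes "autonomous_ds \<Phi>"
    and "global_attractor \<Phi> A0"
    and "metric_dynamical_system P \<theta>"
    and "\<And>\<epsilon>. \<epsilon> > 0 \<Longrightarrow> continuous_rds P \<theta> (\<Phi>\<^sub>\<epsilon> \<epsilon>)"
    and "random_attractor_family P \<theta> D {0<..} \<Phi>\<^sub>\<epsilon> A"
    and "\<And>\<epsilon>. \<epsilon> > 0 \<Longrightarrow> A \<epsilon> \<in> D"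
    and "random_absorbing_family P \<theta> D {0<..} \<Phi>\<^sub>\<epsilon> E"
    and convergence:
      "AE \<omega> in P. \<forall>t\<ge>0. \<forall>e :: nat \<Rightarrow> real. \<forall>xs x.
         (\<forall>n. e n > 0) \<longrightarrow> e \<longlonglongrightarrow> 0 \<longrightarrow> xs \<longlonglongrightarrow> x \<longrightarrow>
         (\<lambda>n. \<Phi>\<^sub>\<epsilon> (e n) t \<omega> (xs n)) \<longlonglongrightarrow> \<Phi> t x"
    and "c > 0"
    and bound:
      "AE \<omega> in P. Limsup (at_right 0) (\<lambda>\<epsilon>. set_norm (E \<epsilon> \<omega>)) \<le> ennreal c"
    and compactness:
      "\<exists>\<epsilon>0>0. AE \<omega> in P. precompact (\<Union>\<epsilon>\<in>{0<..\<epsilon>0}. A \<epsilon> \<omega>)"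
  shows "AE \<omega> in P. ((\<lambda>\<epsilon>. hausdorff_semidist (A \<epsilon> \<omega>) A0) \<longlongrightarrow> 0) (at_right 0)"
proof -
  interpret metric_dynamical_system P \<theta> by fact
  obtain \<epsilon>0 where \<epsilon>0: "\<epsilon>0 > 0" and
    precompact: "AE \<omega> in P. precompact (\<Union>\<epsilon>\<in>{0<..\<epsilon>0}. A \<epsilon> \<omega>)"
    using compactness by blast
  have attractor: "AE \<omega> in P. \<forall>\<epsilon>\<in>{0<..}. random_attractor_at \<theta> D (\<Phi>\<^sub>\<epsilon> \<epsilon>) (A \<epsilon>) \<omega>"
    using assms(5) by (simp add: random_attractor_family_def)
  have absorbs: "AE \<omega> in P. \<forall>\<epsilon>\<in>{0<..}. absorbs_at \<theta> (\<Phi>\<^sub>\<epsilon> \<epsilon>) (E \<epsilon>) (A \<epsilon>) \<omega>"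
    using assms(6,7) by (simp add: random_absorbing_family_def)
  have subset: "AE \<omega> in P. \<forall>\<epsilon>\<in>{0<..}. A \<epsilon> \<omega> \<subseteq> E \<epsilon> \<omega>"
    using AE_shift_nat[OF attractor] absorbs AE_space
  proof eventually_elim
    case (elim \<omega>)
    show ?case
    proof
      fix \<epsilon> :: real assume "\<epsilon> \<in> {0<..}"
      with elim(1) have "random_attractor_at \<theta> D (\<Phi>\<^sub>\<epsilon> \<epsilon>) (A \<epsilon>) (\<theta> (- real m) \<omega>)" for m
        by blast
      moreover have "absorbs_at \<theta> (\<Phi>\<^sub>\<epsilon> \<epsilon>) (E \<epsilon>) (A \<epsilon>) \<omega>"
        using elim(2) \<open>\<epsilon> \<in> {0<..}\<close> by blast
      ultimately show "A \<epsilon> \<omega> \<subseteq> E \<epsilon> \<omega>"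
        by (rule attractor_subset_absorbing[OF elim(3)])
    qed
  qed
  show ?thesis
    using precompact AE_shift_nat[OF precompact] AE_shift_nat[OF attractor] AE_shift_nat[OF subset]
      AE_shift_nat[OF bound] AE_shift_nat[OF convergence] AE_space
  proof eventually_elim
    case (elim \<omega>)
    show ?case
    proof (rule semidist_tendsto_0_if_limit_points[OF \<epsilon>0 elim(1)])
      fix e :: "nat \<Rightarrow> real" and y l
      assume e: "\<And>n. e n > 0" "e \<longlonglongrightarrow> 0" and y: "\<And>n. y n \<in> A (e n) \<omega>" "y \<longlonglongrightarrow> l"
      have "l \<in> \<Phi> (real m) ` cball 0 (c + 1)" for m :: nat
      proof (rule limit_point_in_image_cball[OF \<epsilon>0 _ _ _ _ _ _ _ e y])
        let ?\<omega> = "\<theta> (- real m) \<omega>"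
        show "precompact (\<Union>\<epsilon>\<in>{0<..\<epsilon>0}. A \<epsilon> ?\<omega>)" using elim(2) by blast
        show "A \<epsilon> ?\<omega> \<subseteq> E \<epsilon> ?\<omega>" if "\<epsilon> > 0" for \<epsilon> using elim(4) that by simp
        show "Limsup (at_right 0) (\<lambda>\<epsilon>. set_norm (E \<epsilon> ?\<omega>)) \<le> ennreal c" using elim(5) by blast
        show "0 \<le> c" "c < c + 1" using \<open>c > 0\<close> by simp_all
        show "\<Phi>\<^sub>\<epsilon> \<epsilon> (real m) ?\<omega> ` A \<epsilon> ?\<omega> = A \<epsilon> \<omega>" if "\<epsilon> > 0" for \<epsilon>
          using elim(3,7) that by (intro random_attractor_image_from_past) auto
        show "(\<lambda>n. \<Phi>\<^sub>\<epsilon> (e n) (real m) ?\<omega> (xs n)) \<longlonglongrightarrow> \<Phi> (real m) x"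
          if "\<And>n. e n > 0" "e \<longlonglongrightarrow> 0" "xs \<longlonglongrightarrow> x" for e :: "nat \<Rightarrow> real" and xs x
          using elim(6) that by simp
      qed
      with assms(2) bounded_cball show "point_dist l A0 = 0"
        by (rule point_dist_global_attractor_eq_0)
    qed
  qed
qed

end
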